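(* Let $G=(X,E)$ be a semigraph with $|X|=n$ and $|E|=m$, $E=\{e_1,\dots,e_m\}$, $|e_i|=r_i$, and let $\lambda_1\ge\lambda_2\ge\cdots\ge\lambda_n$ be the eigenvalues of (the adjacency matrix of) $G$. Let $m_2$ be the number of quarter edges of $G$, $m_3$ the number of half edges with one partial half edge, and $m_4$ the number of half edges with two partial half edges. Then $$\lambda_1\le\sqrt{\left(\frac16\sum_{i=1}^{m}r_i^2(r_i^2-1)-\frac{15}{8}m_2-\frac34 m_3-\frac12 m_4\right)\left(\frac{n-1}{n}\right)} .$$
   Context: A semigraph is a pair $G=(V,E)$, where $V$ is a non-empty finite set (vertices) and $E$ is a set of ordered $k$-tuples ($k\ge 2$, $k$ may vary) of distinct vertices (edges), such that any two distinct edges have at most one vertex in common; an edge $(u_1,\dots,u_k)$ is identified with its reversal $(u_k,\dots,u_1)$. For an edge $e=(u_1,\dots,u_k)$, $|e|=k$ is its number of vertices. Standing assumption: semigraphs are connected, i.e. for any two vertices $u,v$ there is a sequence of edges $e_{i_1},\dots,e_{i_p}$ with $u\in e_{i_1}$, $v\in e_{i_p}$ and $|e_{i_j}\cap e_{i_{j+1}}|=1$ for $1\le j\le p-1$. For an edge $(u_1,\dots,u_k)$, $u_1,u_k$ are its end vertices and $u_2,\dots,u_{k-1}$ its middle vertices. A vertex is a pure end vertex if it is an end vertex of every edge containing it; a pure middle vertex if it is a middle vertex of every edge containing it; a middle end vertex if it is a middle vertex of at least one edge and an end vertex of at least one other edge. An edge $(u_1,\dots,u_k)$, $k\ge2$,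 is a full edge if $u_1,u_k$ are pure end vertices. An edge with $k>2$ is a half edge if at least one of $u_1,u_k$ is a middle end vertex. An edge $(u_1,u_2)$ with two vertices is a quarter edge if both are middle end vertices, and a half edge if exactly one is a middle end vertex and the other is a pure end vertex. For a half edge $(u_1,\dots,u_k)$ with $k>2$, the pair $(u_1,u_2)$ is a partial half edge if $u_1$ is a middle end vertex, and $(u_{k-1},u_k)$ is a partial half edge if $u_k$ is a middle end vertex; a half edge with two vertices is itself a partial half edge. With $m_1$ the number of full edges, $m=m_1+m_2+m_3+m_4$. For vertices $u_i,u_j$ of an edge $e=(u_1,\dots,u_k)$ put $d_e(u_i,u_j)=|i-j|$. The adjacency matrix of a semigraph with vertices $v_1,\dots,v_n$ is the symmetric $n\times n$ matrix $A=(a_{ij})$ with: $a_{ij}=d_e(v_i,v_j)$ if $v_i\neq v_j$ belong to a full edge or half edge $e$ and $(v_i,v_j)$ is neither a partial half edge nor a quarter edge; $a_{ij}=\frac12$ if $(v_i,v_j)$ is a partial half edge; $a_{ij}=\frac14$ if $(v_i,v_j)$ is a quarter edge; $a_{ij}=0$ otherwise. The eigenvalues of $G$ are the eigenvalues of $A$, listed with multiplicity. *)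

theory Defs
  imports "Jordan_Normal_Form.Char_Poly" "HOL-Library.Multiset"
begin

text \<open>
  An edge is a list of distinct vertices. Since an edge is identified with its reversal, the set
  \<open>E\<close> holds each edge once, in one of its two orientations: the intersection axiom forbids
  \<open>e\<close> and \<open>rev e\<close> from both being in \<open>E\<close>, as they would have at least two common vertices.
  All notions below are invariant under replacing an edge by its reversal.
\<close>

locale semigraph =
  fixes V :: "'a set" and E :: "'a list set"
  assumes finite_V: "finite V"
    and V_nonempty: "V \<noteq> {}"
    and edge_vertices: "e \<in> E \<Longrightarrow> set e \<subseteq> V"
    and edge_distinct: "e \<in> E \<Longrightarrow> distinct e"
    and edge_length: "e \<in> E \<Longrightarrow> 2 \<le> length e"
    and edge_inter: "e \<in> E \<Longrightarrow> f \<in> E \<Longrightarrow> e \<noteq> f \<Longrightarrow> card (set e \<inter> set f) \<le> 1"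

text \<open>
  Only pairs of different vertices are constrained, so the semigraph with one vertex and no edges
  counts as connected.
\<close>

definition connected_semigraph :: "'a set \<Rightarrow> 'a list set \<Rightarrow> bool" where
  "connected_semigraph V E \<longleftrightarrow>
     (\<forall>u\<in>V. \<forall>w\<in>V. u \<noteq> w \<longrightarrow>
        (\<exists>es. es \<noteq> [] \<and> set es \<subseteq> E \<and> u \<in> set (hd es) \<and> w \<in> set (last es) \<and>
              (\<forall>j. Suc j < length es \<longrightarrow> card (set (es ! j) \<inter> set (es ! Suc j)) = 1)))"

definition end_vertex_of :: "'a \<Rightarrow> 'a list \<Rightarrow> bool" where
  "end_vertex_of u e \<longleftrightarrow> u = hd e \<or> u = last e"

definition middle_vertex_of :: "'a \<Rightarrow> 'a list \<Rightarrow> bool" where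
  "middle_vertex_of u e \<longleftrightarrow> u \<in> set (butlast (tl e))"

definition pure_end_vertex :: "'a list set \<Rightarrow> 'a \<Rightarrow> bool" where
  "pure_end_vertex E u \<longleftrightarrow> (\<forall>e\<in>E. u \<in> set e \<longrightarrow> end_vertex_of u e)"

definition middle_end_vertex :: "'a list set \<Rightarrow> 'a \<Rightarrow> bool" where
  "middle_end_vertex E u \<longleftrightarrow>
     (\<exists>e\<in>E. \<exists>f\<in>E. e \<noteq> f \<and> middle_vertex_of u e \<and> end_vertex_of u f)"

definition full_edge :: "'a list set \<Rightarrow> 'a list \<Rightarrow> bool" where
  "full_edge E e \<longleftrightarrow> e \<in> E \<and> pure_end_vertex E (hd e) \<and> pure_end_vertex E (last e)"

definition half_edge :: "'a list set \<Rightarrow> 'a list \<Rightarrow> bool" where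
  "half_edge E e \<longleftrightarrow> e \<in> E \<and>
     (length e > 2 \<and> (middle_end_vertex E (hd e) \<or> middle_end_vertex E (last e)) \<or>
      length e = 2 \<and> (middle_end_vertex E (hd e) \<and> pure_end_vertex E (last e) \<or>
                       pure_end_vertex E (hd e) \<and> middle_end_vertex E (last e)))"

definition quarter_edge :: "'a list set \<Rightarrow> 'a list \<Rightarrow> bool" where
  "quarter_edge E e \<longleftrightarrow>
     e \<in> E \<and> length e = 2 \<and> middle_end_vertex E (hd e) \<and> middle_end_vertex E (last e)"

text \<open>Partial half edges are recorded as unordered pairs of vertices.\<close>

definition partial_half_edges :: "'a list set \<Rightarrow> 'a list \<Rightarrow> 'a set set" where
  "partial_half_edges E e =
     (if \<not> half_edge E e then {}
      else if length e = 2 then {set e}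
      else (if middle_end_vertex E (hd e) then {{e ! 0, e ! 1}} else {}) \<union>
           (if middle_end_vertex E (last e)
            then {{e ! (length e - 2), e ! (length e - 1)}} else {}))"

definition edge_pos :: "'a list \<Rightarrow> 'a \<Rightarrow> nat" where
  "edge_pos e u = (THE i. i < length e \<and> e ! i = u)"

definition edge_dist :: "'a list \<Rightarrow> 'a \<Rightarrow> 'a \<Rightarrow> real" where
  "edge_dist e u w = \<bar>real (edge_pos e u) - real (edge_pos e w)\<bar>"

text \<open>The edge chosen by \<open>THE\<close> is unique, because two edges share at most one vertex.\<close>

definition adjacency :: "'a list set \<Rightarrow> 'a \<Rightarrow> 'a \<Rightarrow> real" where
  "adjacency E u w =
     (if \<exists>e\<in>E. {u, w} \<in> partial_half_edges E e then 1 / 2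
      else if \<exists>e. quarter_edge E e \<and> {u, w} = set e then 1 / 4
      else if u \<noteq> w \<and> (\<exists>e. (full_edge E e \<or> half_edge E e) \<and> u \<in> set e \<and> w \<in> set e)
      then edge_dist (THE e. e \<in> E \<and> u \<in> set e \<and> w \<in> set e) u w
      else 0)"

text \<open>The list \<open>vs\<close> enumerates the vertices.\<close>

definition adjacency_matrix :: "'a list set \<Rightarrow> 'a list \<Rightarrow> real mat" where
  "adjacency_matrix E vs =
     mat (length vs) (length vs) (\<lambda>(i, j). adjacency E (vs ! i) (vs ! j))"

text \<open>
  Real eigenvalues with algebraic multiplicity, in non-increasing order. For a real symmetric
  matrix these are all the eigenvalues, so the list has as many entries as the matrix has rows.
\<close>

definition eigenvalues_desc :: "real mat \<Rightarrow> real list" where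
  "eigenvalues_desc A = rev (sorted_list_of_multiset (proots (char_poly A)))"

definition num_quarter_edges :: "'a list set \<Rightarrow> nat" where
  "num_quarter_edges E = card {e \<in> E. quarter_edge E e}"

definition num_half_edges_with :: "'a list set \<Rightarrow> nat \<Rightarrow> nat" where
  "num_half_edges_with E p = card {e \<in> E. half_edge E e \<and> card (partial_half_edges E e) = p}"

end

theory Submission
  imports Defs "Jordan_Normal_Form.Schur_Decomposition" "HOL-Analysis.Convex"
begin

text \<open>
  For a real symmetric matrix with zero diagonal, the eigenvalues sum to \<open>0\<close> and their squares sum to
  the sum \<open>s\<close> of the squared entries (triangularise \<open>A\<close> over the reals and compare the traces of \<open>A\<close>
  and \<open>A\<^sup>2\<close>). Since \<open>\<lambda>\<^sub>1\<close> is minus the sum of the other \<open>n - 1\<close> eigenvalues, Cauchy-Schwarz gives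
  \<open>\<lambda>\<^sub>1\<^sup>2 \<le> s (n - 1) / n\<close>.

  As two edges share at most one vertex, the nonzero entries are partitioned by the edges. If all
  entries of an edge with \<open>r\<close> vertices were distances, it would contribute \<open>r\<^sup>2 (r\<^sup>2 - 1) / 6\<close>. A
  quarter edge has two entries \<open>1 / 4\<close> in place of \<open>1\<close>, which saves \<open>2 (1 - 1 / 16) = 15 / 8\<close>. A
  single entry \<open>1 / 2\<close> of a partial half edge saves \<open>1 - 1 / 4 = 3 / 4\<close>, which already covers both
  \<open>3 / 4\<close> and \<open>1 / 2\<close>.
\<close>

subsection \<open>Eigenvalues of real symmetric matrices\<close>

text \<open>For an eigenvector \<open>v\<close>, the form \<open>q\<close> (conjugate of
  \<open>v\<close> against \<open>A v\<close>) equals its own conjugate because \<open>A\<close> is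
  real and symmetric. It also equals \<open>a\<close> times the positive squared norm
  \<open>s\<close>, so \<open>a\<close> equals its conjugate.\<close>

lemma symmetric_mat_eigenvalue_real:
  fixes A :: "real mat"
  assumes A: "A \<in> carrier_mat n n"
    and sym: "\<And>i j. i < n \<Longrightarrow> j < n \<Longrightarrow> A $$ (i, j) = A $$ (j, i)"
    and ev: "eigenvalue (map_mat complex_of_real A) a"
  shows "a \<in> \<real>"
proof -
  obtain v where "eigenvector (map_mat complex_of_real A) v a"
    using ev unfolding eigenvalue_def by blast
  then have v: "dim_vec v = n" "v \<noteq> 0\<^sub>v n"
    and Av: "map_mat complex_of_real A *\<^sub>v v = a \<cdot>\<^sub>v v"
    using A by (simp_all add: eigenvector_def)
  have row: "(\<Sum>j<n. of_real (A $$ (i, j)) * v $ j) = a * v $ i" if "i < n" for i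
  proof -
    have "(\<Sum>j<n. of_real (A $$ (i, j)) * v $ j) = (map_mat complex_of_real A *\<^sub>v v) $ i"
      using that A v(1) by (simp add: scalar_prod_def atLeast0LessThan)
    also have "\<dots> = a * v $ i"
      using that v(1) by (simp add: Av)
    finally show ?thesis .
  qed
  define q where "q = (\<Sum>i<n. cnj (v $ i) * (\<Sum>j<n. of_real (A $$ (i, j)) * v $ j))"
  define s where "s = (\<Sum>i<n. (cmod (v $ i))\<^sup>2)"
  have "q = (\<Sum>i<n. a * (v $ i * cnj (v $ i)))"
    unfolding q_def by (intro sum.cong refl, subst row) (simp_all add: mult_ac)
  then have q: "q = a * of_real s"
    by (simp only: s_def of_real_sum complex_norm_square sum_distrib_left)
  have "cnj q = (\<Sum>i<n. \<Sum>j<n. v $ i * (of_real (A $$ (i, j)) * cnj (v $ j)))"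
    by (simp add: q_def sum_distrib_left)
  also have "\<dots> = (\<Sum>j<n. \<Sum>i<n. v $ i * (of_real (A $$ (i, j)) * cnj (v $ j)))"
    by (rule sum.swap)
  also have "\<dots> = q"
    unfolding q_def sum_distrib_left
    by (intro sum.cong refl) (simp add: sym mult_ac)
  finally have "cnj a * of_real s = a * of_real s"
    by (simp add: q)
  moreover have "s \<noteq> 0"
  proof
    assume "s = 0"
    then have "\<forall>i<n. v $ i = 0"
      by (simp add: s_def sum_nonneg_eq_0_iff)
    with v show False by (metis eq_vecI index_zero_vec)
  qed
  ultimately show ?thesis
    by (simp add: Reals_cnj_iff)
qed

text \<open>The complex roots are eigenvalues, hence real, so the complex factorization is the image
  of a real one; embedding real polynomials into complex ones is injective. This factorization
  permits a Schur decomposition over the reals.\<close>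

lemma symmetric_mat_char_poly_splits:
  fixes A :: "real mat"
  assumes A: "A \<in> carrier_mat n n"
    and sym: "\<And>i j. i < n \<Longrightarrow> j < n \<Longrightarrow> A $$ (i, j) = A $$ (j, i)"
  obtains as where "char_poly A = (\<Prod>a\<leftarrow>as. [:- a, 1:])"
proof -
  interpret of_real_poly: map_poly_inj_idom_divide_hom complex_of_real ..
  let ?A = "map_mat complex_of_real A"
  have cA: "?A \<in> carrier_mat n n" using A by simp
  obtain bs where bs: "char_poly ?A = (\<Prod>b\<leftarrow>bs. [:- b, 1:])"
    using char_poly_factorized[OF cA] by blast
  have "of_real (Re b) = b" if "b \<in> set bs" for b
  proof -
    have "poly (char_poly ?A) b = 0"
      using that linear_poly_root unfolding bs by blast
    then show ?thesis
      using symmetric_mat_eigenvalue_real[OF A sym] eigenvalue_root_char_poly[OF cA]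
      by (simp add: complex_is_Real_iff complex_eq_iff)
  qed
  then have "map_poly complex_of_real (\<Prod>a\<leftarrow>map Re bs. [:- a, 1:]) = (\<Prod>b\<leftarrow>bs. [:- b, 1:])"
    by (induction bs) (simp_all add: hom_distribs)
  also have "\<dots> = map_poly complex_of_real (char_poly A)"
    by (simp add: bs[symmetric] of_real_hom.char_poly_hom[OF A])
  finally have "char_poly A = (\<Prod>a\<leftarrow>map Re bs. [:- a, 1:])"
    by simp
  then show thesis by (rule that)
qed

section \<open>Traces, similarity and sums of eigenvalues\<close>

lemma sum_diag_mult_commute:
  fixes A B :: "'a :: comm_semiring_0 mat"
  assumes "A \<in> carrier_mat n m" "B \<in> carrier_mat m n"
  shows "(\<Sum>i<n. (A * B) $$ (i, i)) = (\<Sum>i<m. (B * A) $$ (i, i))"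
proof -
  have "(\<Sum>i<n. (A * B) $$ (i, i)) = (\<Sum>i<n. \<Sum>j<m. A $$ (i, j) * B $$ (j, i))"
    using assms by (simp add: scalar_prod_def atLeast0LessThan)
  also have "\<dots> = (\<Sum>j<m. \<Sum>i<n. B $$ (j, i) * A $$ (i, j))"
    by (subst sum.swap) (simp add: mult.commute)
  also have "\<dots> = (\<Sum>i<m. (B * A) $$ (i, i))"
    using assms by (simp add: scalar_prod_def atLeast0LessThan)
  finally show ?thesis .
qed

text \<open>Write \<open>A = (P * B) * Q\<close>, move \<open>Q\<close> to the front under the
  trace, and cancel \<open>Q * P = 1\<close>.\<close>

lemma sum_diag_similar:
  fixes A B :: "'a :: comm_ring_1 mat"
  assumes "A \<in> carrier_mat n n" "similar_mat_wit A B P Q"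
  shows "(\<Sum>i<n. A $$ (i, i)) = (\<Sum>i<n. B $$ (i, i))"
proof -
  note w = similar_mat_witD2[OF assms]
  have "(\<Sum>i<n. A $$ (i, i)) = (\<Sum>i<n. (Q * (P * B)) $$ (i, i))"
    using sum_diag_mult_commute[OF mult_carrier_mat[OF w(6) w(5)] w(7)] w(3) by simp
  also have "Q * (P * B) = B"
    using assoc_mult_mat[OF w(7) w(6) w(5)] w(2) w(5) by simp
  finally show ?thesis .
qed

text \<open>\<open>d\<close> is the diagonal of a real Schur form \<open>B\<close> of
  \<open>A\<close>. The same \<open>P\<close> and \<open>Q\<close> make \<open>A * A\<close> similar
  to \<open>B * B\<close>, so both trace identities come from
  \<open>sum_diag_similar\<close>.\<close>

lemma symmetric_mat_eigenvalues:
  fixes A :: "real mat"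
  assumes A: "A \<in> carrier_mat n n"
    and sym: "\<And>i j. i < n \<Longrightarrow> j < n \<Longrightarrow> A $$ (i, j) = A $$ (j, i)"
  obtains d where "proots (char_poly A) = mset (map d [0..<n])"
    and "(\<Sum>i<n. d i) = (\<Sum>i<n. A $$ (i, i))"
    and "(\<Sum>i<n. (d i)\<^sup>2) = (\<Sum>i<n. \<Sum>j<n. (A $$ (i, j))\<^sup>2)"
proof -
  obtain as where "char_poly A = (\<Prod>a\<leftarrow>as. [:- a, 1:])"
    using symmetric_mat_char_poly_splits[OF A sym] by blast
  then obtain B P Q where B: "B \<in> carrier_mat n n" "upper_triangular B"
    and AB: "similar_mat_wit A B P Q"
    using schur_decomposition_exists[OF A] unfolding similar_mat_def by blast
  define d where "d i = B $$ (i, i)" for i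
  have "char_poly A = char_poly B"
    using AB char_poly_similar unfolding similar_mat_def by blast
  also have "\<dots> = (\<Prod>a\<leftarrow>diag_mat B. [:- a, 1:])"
    by (rule char_poly_upper_triangular[OF B])
  also have "diag_mat B = map d [0..<n]"
    using B by (simp add: diag_mat_def d_def)
  finally have c: "char_poly A = (\<Prod>a\<leftarrow>map d [0..<n]. [:- a, 1:])" .
  have "proots (\<Prod>a\<leftarrow>xs. [:- a, 1:]) = mset xs" for xs :: "real list"
  proof (induction xs)
    case (Cons x xs)
    have "(\<Prod>a\<leftarrow>xs. [:- a, 1:]) \<noteq> 0"
      by (auto simp: prod_list_zero_iff)
    then show ?case
      using Cons by (simp add: proots_mult del: mult_pCons_left)
  qed simp
  then have 1: "proots (char_poly A) = mset (map d [0..<n])"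
    unfolding c .
  have 2: "(\<Sum>i<n. d i) = (\<Sum>i<n. A $$ (i, i))"
    using sum_diag_similar[OF A AB] by (simp add: d_def)
  have "similar_mat_wit (A * A) (B * B) P Q"
  proof -
    have "similar_mat_wit (A ^\<^sub>m 2) (B ^\<^sub>m 2) P Q"
      by (rule similar_mat_wit_pow[OF AB])
    then show ?thesis
      using A B by (simp add: numeral_2_eq_2)
  qed
  then have "(\<Sum>i<n. (A * A) $$ (i, i)) = (\<Sum>i<n. (B * B) $$ (i, i))"
    by (rule sum_diag_similar[OF mult_carrier_mat[OF A A]])
  moreover have "(A * A) $$ (i, i) = (\<Sum>j<n. (A $$ (i, j))\<^sup>2)" if "i < n" for i
    using that A by (simp add: scalar_prod_def atLeast0LessThan power2_eq_square sym)
  moreover have "(B * B) $$ (i, i) = (d i)\<^sup>2" if "i < n" for i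
  proof -
    have "(B * B) $$ (i, i) = (\<Sum>j<n. B $$ (i, j) * B $$ (j, i))"
      using that B by (simp add: scalar_prod_def atLeast0LessThan)
    \<comment> \<open>For \<open>j < i\<close> the first factor lies below the diagonal of
      \<open>B\<close>, for \<open>j > i\<close> the second one does.\<close>
    also have "\<dots> = (\<Sum>j\<in>{i}. B $$ (i, j) * B $$ (j, i))"
    proof (rule sum.mono_neutral_right)
      show "\<forall>j\<in>{..<n} - {i}. B $$ (i, j) * B $$ (j, i) = 0"
      proof
        fix j assume "j \<in> {..<n} - {i}"
        then show "B $$ (i, j) * B $$ (j, i) = 0"
          using B that by (cases "j < i") (auto simp: upper_triangular_def)
      qed
    qed (use that in auto)
    finally show ?thesis by (simp add: d_def power2_eq_square)
  qed
  ultimately have 3: "(\<Sum>i<n. (d i)\<^sup>2) = (\<Sum>i<n. \<Sum>j<n. (A $$ (i, j))\<^sup>2)"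
    by simp
  show thesis by (rule that[OF 1 2 3])
qed

lemma square_le_sum_squares_of_sum_zero:
  fixes d :: "'i \<Rightarrow> real"
  assumes "finite I" "i \<in> I" "(\<Sum>j\<in>I. d j) = 0"
  shows "real (card I) * (d i)\<^sup>2 \<le> (real (card I) - 1) * (\<Sum>j\<in>I. (d j)\<^sup>2)"
proof -
  have c: "card I > 0" using assms card_gt_0_iff by blast
  have "(d i)\<^sup>2 = (\<Sum>j\<in>I - {i}. d j)\<^sup>2"
    using assms by (simp add: sum_diff1 power2_eq_square)
  also have "\<dots> \<le> (\<Sum>j\<in>I - {i}. (d j)\<^sup>2) * card (I - {i})"
    by (rule sum_squared_le_sum_of_squares)
  \<comment> \<open>The sum of squares over \<open>I - {i}\<close> is the full sum minus the square
    of \<open>d i\<close>. Moving that part to the left raises the coefficient there from 1 to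
    \<open>card I\<close>.\<close>
  finally show ?thesis
    using assms c by (simp add: sum_diff1 card_Diff_singleton of_nat_diff algebra_simps)
qed

lemma hd_eigenvalues_desc_square_le:
  assumes A: "A \<in> carrier_mat n n" and "n > 0"
    and sym: "\<And>i j. i < n \<Longrightarrow> j < n \<Longrightarrow> A $$ (i, j) = A $$ (j, i)"
    and tr: "(\<Sum>i<n. A $$ (i, i)) = 0"
  shows "(eigenvalues_desc A ! 0)\<^sup>2
    \<le> (\<Sum>i<n. \<Sum>j<n. (A $$ (i, j))\<^sup>2) * ((real n - 1) / real n)"
proof -
  obtain d where d: "proots (char_poly A) = mset (map d [0..<n])"
    and s: "(\<Sum>i<n. d i) = (\<Sum>i<n. A $$ (i, i))"
      "(\<Sum>i<n. (d i)\<^sup>2) = (\<Sum>i<n. \<Sum>j<n. (A $$ (i, j))\<^sup>2)"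
    using symmetric_mat_eigenvalues[OF A sym] by blast
  have "mset (eigenvalues_desc A) = mset (map d [0..<n])"
    by (simp add: eigenvalues_desc_def d)
  from mset_eq_setD[OF this] mset_eq_length[OF this]
  have "set (eigenvalues_desc A) = d ` {..<n}" "length (eigenvalues_desc A) = n"
    by (simp_all add: atLeast0LessThan)
  \<comment> \<open>Since \<open>n > 0\<close>, the list is nonempty and its entry 0 is a genuine
    eigenvalue.\<close>
  then obtain i where "i < n" "eigenvalues_desc A ! 0 = d i"
    using \<open>n > 0\<close> by (metis imageE lessThan_iff nth_mem)
  moreover have "real n * (d i)\<^sup>2 \<le> (real n - 1) * (\<Sum>j<n. (d j)\<^sup>2)"
    using square_le_sum_squares_of_sum_zero[of "{..<n}" i d] s(1) tr \<open>i < n\<close> by simp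
  ultimately show ?thesis
    using \<open>n > 0\<close> by (simp add: s(2) field_simps)
qed

subsection \<open>The squared entries of the adjacency matrix\<close>

text \<open>Passing from \<open>r\<close> to \<open>Suc r\<close> adds one row and one column with
  equal sums; the new corner is 0.\<close>

lemma sum_square_diff_nat:
  "(\<Sum>i<r. \<Sum>j<r. (real i - real j)\<^sup>2) = (real r)\<^sup>2 * ((real r)\<^sup>2 - 1) / 6"
proof (induction r)
  case (Suc r)
  \<comment> \<open>The closed form expands the square and inserts the sums of \<open>j\<close> and
    of its square. The base \<open>x\<close> is independent of \<open>k\<close> so that the
    induction on \<open>k\<close> can keep it fixed; the row needed has both equal to
    \<open>r\<close>.\<close>
  have row: "(\<Sum>j<k. (x - real j)\<^sup>2)
      = real k * x\<^sup>2 - real k * (real k - 1) * x + (real k - 1) * real k * (2 * real k - 1) / 6"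
    for x :: real and k
    by (induction k) (simp_all add: field_simps power2_eq_square)
  have "(\<Sum>i<Suc r. \<Sum>j<Suc r. (real i - real j)\<^sup>2)
      = (\<Sum>i<r. \<Sum>j<r. (real i - real j)\<^sup>2) + 2 * (\<Sum>j<r. (real r - real j)\<^sup>2)"
    by (simp add: sum.distrib power2_commute[of _ "real r"])
  also have "\<dots> = (real (Suc r))\<^sup>2 * ((real (Suc r))\<^sup>2 - 1) / 6"
    unfolding Suc.IH unfolding row by (simp add: field_simps power2_eq_square)
  finally show ?case .
qed simp

lemma edge_pos_nth: "distinct e \<Longrightarrow> i < length e \<Longrightarrow> edge_pos e (e ! i) = i"
  unfolding edge_pos_def by (rule the_equality) (auto simp: nth_eq_iff_index_eq)

lemma edge_dist_nth:
  "distinct e \<Longrightarrow> i < length e \<Longrightarrow> j < length e \<Longrightarrow> edge_dist e (e ! i) (e ! j) = \<bar>real i - real j\<bar>"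
  by (simp add: edge_dist_def edge_pos_nth)

text \<open>This makes every entry 1/2 or 1/4 smaller than the distance that it replaces.\<close>

lemma edge_dist_ge_1:
  assumes "distinct e" "u \<in> set e" "w \<in> set e" "u \<noteq> w"
  shows "1 \<le> edge_dist e u w"
proof -
  obtain i j where ij: "i < length e" "u = e ! i" "j < length e" "w = e ! j"
    using assms by (auto simp: in_set_conv_nth)
  with \<open>u \<noteq> w\<close> have "i \<noteq> j" by auto
  then have "1 \<le> \<bar>real i - real j\<bar>" by linarith
  then show ?thesis using ij assms(1) by (simp add: edge_dist_nth)
qed

lemma edge_dist_commute: "edge_dist e u w = edge_dist e w u"
  by (simp add: edge_dist_def abs_minus_commute)

text \<open>The off-diagonal matrix positions that belong to an edge. Pairs are ordered, so each
  unordered pair accounts for two symmetric entries.\<close>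

definition vertex_pairs :: "'a list \<Rightarrow> ('a \<times> 'a) set" where
  "vertex_pairs e = {(u, w). u \<in> set e \<and> w \<in> set e \<and> u \<noteq> w}"

lemma finite_vertex_pairs [simp]: "finite (vertex_pairs e)"
  by (rule finite_subset[of _ "set e \<times> set e"]) (auto simp: vertex_pairs_def)

lemma sum_vertex_pairs_edge_dist:
  assumes "distinct e"
  shows "(\<Sum>(u, w)\<in>vertex_pairs e. (edge_dist e u w)\<^sup>2)
    = (real (length e))\<^sup>2 * ((real (length e))\<^sup>2 - 1) / 6"
proof -
  have bij: "bij_betw ((!) e) {..<length e} (set e)"
    using assms by (rule bij_betw_nth) auto
  \<comment> \<open>The diagonal pairs can be added because their distance is 0.\<close>
  have "(\<Sum>(u, w)\<in>vertex_pairs e. (edge_dist e u w)\<^sup>2)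
      = (\<Sum>(u, w)\<in>set e \<times> set e. (edge_dist e u w)\<^sup>2)"
    by (rule sum.mono_neutral_left) (auto simp: vertex_pairs_def edge_dist_def)
  also have "\<dots> = (\<Sum>u\<in>set e. \<Sum>w\<in>set e. (edge_dist e u w)\<^sup>2)"
    by (simp add: sum.cartesian_product)
  also have "\<dots> = (\<Sum>i<length e. \<Sum>j<length e. (edge_dist e (e ! i) (e ! j))\<^sup>2)"
    by (simp add: sum.reindex_bij_betw[OF bij, symmetric])
  also have "\<dots> = (\<Sum>i<length e. \<Sum>j<length e. (real i - real j)\<^sup>2)"
    using assms by (simp add: edge_dist_nth)
  finally show ?thesis by (simp only: sum_square_diff_nat)
qed

lemma adjacency_commute: "adjacency E u w = adjacency E w u"
  unfolding adjacency_def
  by (simp only: insert_commute[of u w] conj_commute[of "u \<in> set _"] edge_dist_commute[of _ u w]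
      eq_commute[of u w])

section \<open>Entries of the adjacency matrix, edge by edge\<close>

context semigraph
begin

lemma partial_half_edge_consecutive:
  assumes "e \<in> E" "p \<in> partial_half_edges E e"
  obtains i where "Suc i < length e" "p = {e ! i, e ! Suc i}"
proof -
  have len: "2 \<le> length e" by (rule edge_length[OF assms(1)])
  have "set e = {e ! 0, e ! Suc 0}" if "length e = 2"
    using that by (auto simp: length_Suc_conv numeral_2_eq_2)
  moreover have "Suc (length e - 2) = length e - 1"
    using len by simp
  ultimately have "p = {e ! 0, e ! Suc 0} \<or> p = {e ! (length e - 2), e ! Suc (length e - 2)}"
    using assms(2) by (simp add: partial_half_edges_def split: if_splits)
  then show thesis
    using len that[of 0] that[of "length e - 2"] by fastforce
qed

lemma partial_half_edge_vertex_pair: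
  assumes "e \<in> E" "{u, w} \<in> partial_half_edges E e"
  shows "(u, w) \<in> vertex_pairs e"
proof -
  obtain i where i: "Suc i < length e" "{u, w} = {e ! i, e ! Suc i}"
    using partial_half_edge_consecutive[OF assms] by blast
  moreover have "e ! i \<noteq> e ! Suc i"
    using i(1) edge_distinct[OF assms(1)] by (simp add: nth_eq_iff_index_eq)
  ultimately show ?thesis
    by (auto simp: vertex_pairs_def doubleton_eq_iff)
qed

lemma quarter_edge_vertex_pair:
  assumes "quarter_edge E e" "{u, w} = set e"
  shows "(u, w) \<in> vertex_pairs e"
proof -
  have "card {u, w} = 2"
    using assms edge_distinct distinct_card by (metis quarter_edge_def)
  then have "u \<noteq> w" by auto
  then show ?thesis
    using assms(2) by (auto simp: vertex_pairs_def)
qed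

text \<open>Two different common vertices would violate \<open>edge_inter\<close>. Hence different
  edges own disjoint sets of positions, and squared entries can be summed per edge.\<close>

lemma vertex_pairs_unique:
  assumes "e \<in> E" "f \<in> E" "(u, w) \<in> vertex_pairs e" "(u, w) \<in> vertex_pairs f"
  shows "e = f"
proof (rule ccontr)
  assume "e \<noteq> f"
  then have "card (set e \<inter> set f) \<le> 1"
    using assms edge_inter by blast
  moreover have "card {u, w} \<le> card (set e \<inter> set f)"
    using assms by (intro card_mono) (auto simp: vertex_pairs_def)
  ultimately show False
    using assms(3) by (simp add: vertex_pairs_def)
qed

text \<open>Each nonzero case of \<open>adjacency\<close> comes from an edge containing both
  vertices. With \<open>w = u\<close> this also yields the zero diagonal.\<close>

lemma adjacency_eq_0:
  assumes "\<And>e. e \<in> E \<Longrightarrow> (u, w) \<notin> vertex_pairs e"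
  shows "adjacency E u w = 0"
proof -
  have half: "\<not> (\<exists>e\<in>E. {u, w} \<in> partial_half_edges E e)"
    using assms partial_half_edge_vertex_pair by blast
  have quarter: "\<not> (\<exists>e. quarter_edge E e \<and> {u, w} = set e)"
    using assms quarter_edge_vertex_pair by (metis quarter_edge_def)
  have other: "\<not> (u \<noteq> w \<and> (\<exists>e. (full_edge E e \<or> half_edge E e) \<and> u \<in> set e \<and> w \<in> set e))"
    using assms by (auto simp: vertex_pairs_def full_edge_def half_edge_def)
  show ?thesis
    unfolding adjacency_def if_not_P[OF half] if_not_P[OF quarter] if_not_P[OF other] ..
qed

text \<open>As \<open>e\<close> is the only edge through both vertices, the existential conditions
  and the \<open>THE\<close> in \<open>adjacency\<close> all reduce to \<open>e\<close>
  itself.\<close>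

lemma adjacency_vertex_pair:
  assumes e: "e \<in> E" and uw: "(u, w) \<in> vertex_pairs e"
  shows "adjacency E u w =
    (if {u, w} \<in> partial_half_edges E e then 1 / 2
     else if quarter_edge E e then 1 / 4
     else if full_edge E e \<or> half_edge E e then edge_dist e u w
     else 0)"
proof -
  have uniq: "f = e" if "f \<in> E" "u \<in> set f" "w \<in> set f" for f
    using vertex_pairs_unique[OF that(1) e _ uw] uw that by (simp add: vertex_pairs_def)
  have "(\<exists>f\<in>E. {u, w} \<in> partial_half_edges E f) \<longleftrightarrow> {u, w} \<in> partial_half_edges E e"
    using e uw partial_half_edge_vertex_pair vertex_pairs_unique by blast
  moreover have "(\<exists>f. quarter_edge E f \<and> {u, w} = set f) \<longleftrightarrow> quarter_edge E e"
  proof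
    assume q: "quarter_edge E e"
    then have "card (set e) = card {u, w}"
      using uw edge_distinct[OF e]
      by (simp add: quarter_edge_def vertex_pairs_def distinct_card)
    then have "{u, w} = set e"
      using uw by (intro card_subset_eq) (auto simp: vertex_pairs_def)
    with q show "\<exists>f. quarter_edge E f \<and> {u, w} = set f" by blast
  next
    assume "\<exists>f. quarter_edge E f \<and> {u, w} = set f"
    then obtain f where f: "quarter_edge E f" "{u, w} = set f" by blast
    then have "f = e"
      by (intro uniq) (auto simp: quarter_edge_def)
    with f show "quarter_edge E e" by simp
  qed
  moreover have "(u \<noteq> w \<and> (\<exists>f. (full_edge E f \<or> half_edge E f) \<and> u \<in> set f \<and> w \<in> set f))
      \<longleftrightarrow> full_edge E e \<or> half_edge E e"
    using uw uniq by (auto simp: vertex_pairs_def full_edge_def half_edge_def)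
  moreover have "(THE f. f \<in> E \<and> u \<in> set f \<and> w \<in> set f) = e"
  proof (rule the_equality)
    show "e \<in> E \<and> u \<in> set e \<and> w \<in> set e"
      using e uw by (simp add: vertex_pairs_def)
  qed (use uniq in blast)
  ultimately show ?thesis
    unfolding adjacency_def by (simp only:)
qed

text \<open>A middle end vertex is interior to some edge and, by distinctness, is not an end of it,
  so it is never a pure end vertex. A half edge with two vertices needs a pure end.\<close>

lemma quarter_edge_not_half:
  assumes "quarter_edge E e"
  shows "\<not> half_edge E e"
proof -
  have "\<not> pure_end_vertex E u" if u: "middle_end_vertex E u" for u
  proof -
    obtain f where f: "f \<in> E" "u \<in> set (butlast (tl f))"
      using u by (auto simp: middle_end_vertex_def middle_vertex_of_def)
    then have fne: "f \<noteq> []" "tl f \<noteq> []" by auto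
    have "distinct f" using f edge_distinct by blast
    moreover have "f = hd f # butlast (tl f) @ [last f]"
      using fne by (metis append_butlast_last_id last_tl list.collapse)
    ultimately have "u \<noteq> hd f" "u \<noteq> last f"
      using f(2) by (metis Un_iff distinct.simps(2) set_append,
          metis disjoint_iff distinct.simps(2) distinct_append list.set_intros(1))
    moreover have "u \<in> set f"
      using f(2) fne by (metis in_set_butlastD list.set_sel(2))
    ultimately show ?thesis
      using f(1) by (auto simp: pure_end_vertex_def end_vertex_of_def)
  qed
  then show ?thesis
    using assms by (auto simp: quarter_edge_def half_edge_def)
qed

lemma sum_adjacency_vertex_pairs_le:
  assumes e: "e \<in> E"
  shows "(\<Sum>(u, w)\<in>vertex_pairs e. (adjacency E u w)\<^sup>2)
    \<le> (real (length e))\<^sup>2 * ((real (length e))\<^sup>2 - 1) / 6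
      - 15 / 8 * of_bool (quarter_edge E e)
      - 3 / 4 * of_bool (half_edge E e \<and> partial_half_edges E e \<noteq> {})"
proof -
  \<comment> \<open>\<open>g\<close> is the saving at a position compared with a plain distance. It
    is nonnegative on the pairs of \<open>e\<close>, so any selection of them bounds the total
    saving from below.\<close>
  define g where "g = (\<lambda>(u, w). (edge_dist e u w)\<^sup>2 - (adjacency E u w)\<^sup>2)"
  have dist: "1 \<le> edge_dist e u w" if "(u, w) \<in> vertex_pairs e" for u w
    using that edge_distinct[OF e] by (auto simp: vertex_pairs_def intro: edge_dist_ge_1)
  have sq: "1 \<le> (edge_dist e u w)\<^sup>2" if "(u, w) \<in> vertex_pairs e" for u w
    using dist[OF that] by (simp add: one_le_power)
  have g_nonneg: "0 \<le> g p" if "p \<in> vertex_pairs e" for p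
  proof -
    obtain u w where p: "p = (u, w)" by (cases p)
    have "0 \<le> adjacency E u w" "adjacency E u w \<le> edge_dist e u w"
      using that dist[of u w] by (auto simp: p adjacency_vertex_pair[OF e])
    then show ?thesis
      by (simp add: g_def p power_mono)
  qed
  have total: "(\<Sum>(u, w)\<in>vertex_pairs e. (adjacency E u w)\<^sup>2)
      = (real (length e))\<^sup>2 * ((real (length e))\<^sup>2 - 1) / 6 - sum g (vertex_pairs e)"
    using sum_vertex_pairs_edge_dist[OF edge_distinct[OF e]]
    by (simp add: g_def case_prod_unfold sum_subtractf)
  have "15 / 8 * of_bool (quarter_edge E e)
      + 3 / 4 * of_bool (half_edge E e \<and> partial_half_edges E e \<noteq> {}) \<le> sum g (vertex_pairs e)"
  proof (cases "quarter_edge E e")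
    case True
    then have nh: "\<not> half_edge E e" by (rule quarter_edge_not_half)
    obtain x y where xy: "e = [x, y]"
      using True by (auto simp: quarter_edge_def length_Suc_conv numeral_2_eq_2)
    with e have "x \<noteq> y" using edge_distinct by fastforce
    then have pairs: "vertex_pairs e = {(x, y), (y, x)}"
      by (auto simp: vertex_pairs_def xy)
    have "15 / 16 \<le> g p" if "p \<in> vertex_pairs e" for p
    proof -
      obtain u w where p: "p = (u, w)" by (cases p)
      \<comment> \<open>A quarter edge is not a half edge, so it has no partial half edges and the
        case 1/4 is reached.\<close>
      then have quarter: "adjacency E u w = 1 / 4"
        using that nh True by (simp add: adjacency_vertex_pair[OF e] partial_half_edges_def)
      then show ?thesis
        using sq[of u w] that by (simp add: g_def p quarter power_divide)
    qed
    then have "of_nat (card (vertex_pairs e)) * (15 / 16) \<le> sum g (vertex_pairs e)"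
      by (rule sum_bounded_below)
    then show ?thesis
      using \<open>x \<noteq> y\<close> True nh by (simp add: pairs)
  next
    case False
    show ?thesis
    proof (cases "half_edge E e \<and> partial_half_edges E e \<noteq> {}")
      case True
      then obtain q where q: "q \<in> partial_half_edges E e" by blast
      then obtain u w where "q = {u, w}"
        using partial_half_edge_consecutive[OF e] by blast
      with q have uw: "{u, w} \<in> partial_half_edges E e" by simp
      then have p: "(u, w) \<in> vertex_pairs e"
        by (rule partial_half_edge_vertex_pair[OF e])
      have "3 / 4 \<le> g (u, w)"
        using sq[OF p] uw by (simp add: g_def adjacency_vertex_pair[OF e p] power2_eq_square)
      also have "\<dots> \<le> sum g (vertex_pairs e)"
        using p g_nonneg by (intro member_le_sum) auto
      finally show ?thesis using False by simp
    next
      case no_pair: False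
      have "0 \<le> sum g (vertex_pairs e)"
        using g_nonneg by (simp add: sum_nonneg)
      then show ?thesis
        using no_pair \<open>\<not> quarter_edge E e\<close> by auto
    qed
  qed
  then show ?thesis using total by linarith
qed

lemma sum_adjacency_square_le:
  assumes "finite E"
  shows "(\<Sum>u\<in>V. \<Sum>w\<in>V. (adjacency E u w)\<^sup>2)
    \<le> 1 / 6 * (\<Sum>e\<in>E. (real (length e))\<^sup>2 * ((real (length e))\<^sup>2 - 1))
      - 15 / 8 * real (num_quarter_edges E) - 3 / 4 * real (num_half_edges_with E 1)
      - 1 / 2 * real (num_half_edges_with E 2)"
proof -
  let ?a = "\<lambda>(u, w). (adjacency E u w)\<^sup>2"
  let ?h = "\<lambda>k e. half_edge E e \<and> card (partial_half_edges E e) = k"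
  have "(\<Sum>u\<in>V. \<Sum>w\<in>V. (adjacency E u w)\<^sup>2) = sum ?a (V \<times> V)"
    by (rule sum.cartesian_product)
  also have "\<dots> = sum ?a (\<Union>e\<in>E. vertex_pairs e)"
  proof (rule sum.mono_neutral_right)
    show "(\<Union>e\<in>E. vertex_pairs e) \<subseteq> V \<times> V"
      using edge_vertices by (fastforce simp: vertex_pairs_def)
    show "\<forall>p\<in>V \<times> V - (\<Union>e\<in>E. vertex_pairs e). ?a p = 0"
      using adjacency_eq_0 by fastforce
  qed (simp add: finite_V)
  also have "\<dots> = (\<Sum>e\<in>E. sum ?a (vertex_pairs e))"
    using assms vertex_pairs_unique by (intro sum.UNION_disjoint) auto
  also have "\<dots> \<le> (\<Sum>e\<in>E. 1 / 6 * ((real (length e))\<^sup>2 * ((real (length e))\<^sup>2 - 1))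
      - 15 / 8 * of_bool (quarter_edge E e) - 3 / 4 * of_bool (?h 1 e) - 1 / 2 * of_bool (?h 2 e))"
  proof (rule sum_mono)
    fix e assume "e \<in> E"
    \<comment> \<open>The counts 1 and 2 exclude each other, and either one forces the set of
      partial half edges to be nonempty; so at most 3/4 is charged to \<open>e\<close>.\<close>
    have "3 / 4 * of_bool (?h 1 e) + 1 / 2 * of_bool (?h 2 e)
        \<le> (3 / 4 * of_bool (half_edge E e \<and> partial_half_edges E e \<noteq> {}) :: real)"
      by auto
    with sum_adjacency_vertex_pairs_le[OF \<open>e \<in> E\<close>]
    show "sum ?a (vertex_pairs e) \<le> 1 / 6 * ((real (length e))\<^sup>2 * ((real (length e))\<^sup>2 - 1))
      - 15 / 8 * of_bool (quarter_edge E e) - 3 / 4 * of_bool (?h 1 e) - 1 / 2 * of_bool (?h 2 e)"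
      by linarith
  qed
  also have "\<dots> = 1 / 6 * (\<Sum>e\<in>E. (real (length e))\<^sup>2 * ((real (length e))\<^sup>2 - 1))
      - 15 / 8 * real (num_quarter_edges E) - 3 / 4 * real (num_half_edges_with E 1)
      - 1 / 2 * real (num_half_edges_with E 2)"
    unfolding sum_subtractf sum_distrib_left[symmetric] num_quarter_edges_def num_half_edges_with_def
    by (simp add: assms Int_def)
  finally show ?thesis .
qed

end

theorem theorem3p4:
  fixes V :: "'a set" and E :: "'a list set"
    and vs :: "'a list" and e :: "nat \<Rightarrow> 'a list"
    and n m m2 m3 m4 :: nat and r :: "nat \<Rightarrow> nat" and lam :: "nat \<Rightarrow> real"
  assumes "semigraph V E" and "connected_semigraph V E"
    and "card V = n" and "card E = m"
    and "distinct vs" and "set vs = V"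
    and "bij_betw e {1..m} E"
    and "\<And>i. i \<in> {1..m} \<Longrightarrow> r i = length (e i)"
    and "\<And>i. i \<in> {1..n} \<Longrightarrow> lam i = eigenvalues_desc (adjacency_matrix E vs) ! (i - 1)"
    and "m2 = num_quarter_edges E"
    and "m3 = num_half_edges_with E 1"
    and "m4 = num_half_edges_with E 2"
  shows "lam 1 \<le>
    sqrt ((1 / 6 * (\<Sum>i = 1..m. (real (r i))\<^sup>2 * ((real (r i))\<^sup>2 - 1))
            - 15 / 8 * real m2 - 3 / 4 * real m3 - 1 / 2 * real m4)
          * ((real n - 1) / real n))"
proof -
  interpret semigraph V E by fact
  let ?A = "adjacency_matrix E vs"
  have n: "length vs = n" "n > 0"
    using assms finite_V V_nonempty by (auto simp: distinct_card[symmetric] card_gt_0_iff)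
  have entry: "?A $$ (i, j) = adjacency E (vs ! i) (vs ! j)" if "i < n" "j < n" for i j
    using that n by (simp add: adjacency_matrix_def)
  have A: "?A \<in> carrier_mat n n"
    using n by (simp add: adjacency_matrix_def)
  have sym: "?A $$ (i, j) = ?A $$ (j, i)" if "i < n" "j < n" for i j
    using that by (simp add: entry adjacency_commute)
  have "adjacency E u u = 0" for u
    by (rule adjacency_eq_0) (simp add: vertex_pairs_def)
  then have tr: "(\<Sum>i<n. ?A $$ (i, i)) = 0"
    by (simp add: entry)
  have bij: "bij_betw ((!) vs) {..<n} V"
    using assms n by (intro bij_betw_nth) auto
  have "(\<Sum>i<n. \<Sum>j<n. (?A $$ (i, j))\<^sup>2) = (\<Sum>u\<in>V. \<Sum>w\<in>V. (adjacency E u w)\<^sup>2)"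
    by (simp add: entry sum.reindex_bij_betw[OF bij, symmetric])
  also have "\<dots> \<le> 1 / 6 * (\<Sum>e\<in>E. (real (length e))\<^sup>2 * ((real (length e))\<^sup>2 - 1))
      - 15 / 8 * real m2 - 3 / 4 * real m3 - 1 / 2 * real m4"
    unfolding \<open>m2 = _\<close> \<open>m3 = _\<close> \<open>m4 = _\<close>
    using bij_betw_finite[OF \<open>bij_betw e {1..m} E\<close>] by (intro sum_adjacency_square_le) simp
  also have "(\<Sum>e\<in>E. (real (length e))\<^sup>2 * ((real (length e))\<^sup>2 - 1))
      = (\<Sum>i = 1..m. (real (r i))\<^sup>2 * ((real (r i))\<^sup>2 - 1))"
    using assms(8) by (simp add: sum.reindex_bij_betw[OF \<open>bij_betw e {1..m} E\<close>, symmetric])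
  finally have bound: "(\<Sum>i<n. \<Sum>j<n. (?A $$ (i, j))\<^sup>2)
      \<le> 1 / 6 * (\<Sum>i = 1..m. (real (r i))\<^sup>2 * ((real (r i))\<^sup>2 - 1))
        - 15 / 8 * real m2 - 3 / 4 * real m3 - 1 / 2 * real m4" .
  \<comment> \<open>\<open>lam\<close> counts from 1, the list of eigenvalues from 0.\<close>
  have "(lam 1)\<^sup>2 = (eigenvalues_desc ?A ! 0)\<^sup>2"
    using assms(9)[of 1] n by simp
  also have "\<dots> \<le> (\<Sum>i<n. \<Sum>j<n. (?A $$ (i, j))\<^sup>2) * ((real n - 1) / real n)"
    by (rule hd_eigenvalues_desc_square_le[OF A n(2) sym tr])
  also have "\<dots> \<le> (1 / 6 * (\<Sum>i = 1..m. (real (r i))\<^sup>2 * ((real (r i))\<^sup>2 - 1))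
        - 15 / 8 * real m2 - 3 / 4 * real m3 - 1 / 2 * real m4) * ((real n - 1) / real n)"
    using n by (intro mult_right_mono bound) simp
  \<comment> \<open>A bound on the square bounds the number itself by the square root, whatever its
    sign.\<close>
  finally show ?thesis
    by (rule real_le_rsqrt)
qed

end
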